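(* Let $\lambda X$ be a supersorted pure type system. Then for every context $\Gamma$, variable $x$ and pseudoterms $A,M,B$: if $\Gamma,x:A\vdash M:B$ is derivable in $\lambda X$, then $\Gamma\vdash(\lambda x{:}A.M):(\Pi x{:}A.B)$ is derivable in $\lambda X$. Consequently, in $\lambda X$ the (abstraction) rule can be replaced by the rule "from $\Gamma,x:A\vdash M:B$ infer $\Gamma\vdash(\lambda x{:}A.M):(\Pi x{:}A.B)$" without changing the set of derivable judgements.
   Context: Pure type systems (PTS): a PTS has variables, constants $\mathcal C$, sorts $\mathcal S\subseteq\mathcal C$, axioms $\mathcal A$ ($c:s$), rules $\mathcal R\subseteq\mathcal S^3$; pseudoterms $\mathcal T::=V\mid\mathcal C\mid\Pi V{:}\mathcal T.\mathcal T\mid\lambda V{:}\mathcal T.\mathcal T\mid\mathcal T\mathcal T$; derivable judgements $\Gamma\vdash M:A$ ($\Gamma$ a finite sequence of declarations $x:A$) are generated by (axiom) $\vdash c:s$ for $(c:s)\in\mathcal A$; (start) $\Gamma\vdash A:s\Rightarrow\Gamma,x:A\vdash x:A$ ($x$ fresh); (weakening) $\Gamma\vdash M:B$, $\Gamma\vdash A:s\Rightarrow\Gamma,x:A\vdash M:B$ ($x$ fresh); (application) $\Gamma\vdash M:\Pi x{:}A.B$, $\Gamma\vdash N:A\Rightarrow\Gamma\vdash MN:B[x:=N]$; (abstraction) $\Gamma,x:A\vdash M:B$, $\Gamma\vdash(\Pi x{:}A.B):s\Rightarrow\Gamma\vdash(\lambda x{:}A.M):(\Pi x{:}A.B)$;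 (product) $\Gamma,x:A\vdash B:s_2$, $\Gamma\vdash A:s_1$, $(s_1,s_2,s_3)\in\mathcal R\Rightarrow\Gamma\vdash(\Pi x{:}A.B):s_3$; (conversion) $\Gamma\vdash M:A$, $\Gamma\vdash B:s$, $A=_\beta B\Rightarrow\Gamma\vdash M:B$ (with $s,s_i\in\mathcal S$). A PTS is supersorted if for every $c\in\mathcal C$ there is $s\in\mathcal S$ with $(c:s)\in\mathcal A$, and for all $s_1,s_2\in\mathcal S$ there is $s_3\in\mathcal S$ with $(s_1,s_2,s_3)\in\mathcal R$. *)

theory Defs
  imports "HOL-Library.Infinite_Typeclass"
begin

section \<open>Pseudoterms\<close>

text \<open>
  Pseudoterms are taken up to renaming of bound variables. An alpha-equivalence class is
  represented by its locally nameless normal form: free variables carry names, bound variables are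
  de Bruijn indices, and no index is dangling (\<open>lc_at 0\<close>). The named binders
  \<open>\<lambda>x:A. M\<close> and \<open>\<Pi>x:A. B\<close> are then operations \<open>Lam x A M\<close> and \<open>PiTy x A B\<close> on the type
  \<open>pterm\<close>, for which the lemmas of this section derive the laws that are characteristic of
  terms modulo alpha.
\<close>

datatype ('v, 'c) lnterm =
    LVar 'v
  | LBound nat
  | LConst 'c
  | LProd "('v, 'c) lnterm" "('v, 'c) lnterm"
  | LLam "('v, 'c) lnterm" "('v, 'c) lnterm"
  | LApp "('v, 'c) lnterm" "('v, 'c) lnterm"

primrec lc_at :: "nat \<Rightarrow> ('v, 'c) lnterm \<Rightarrow> bool" where
  "lc_at k (LVar x) = True"
| "lc_at k (LBound i) = (i < k)"
| "lc_at k (LConst c) = True"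
| "lc_at k (LProd A B) = (lc_at k A \<and> lc_at (Suc k) B)"
| "lc_at k (LLam A M) = (lc_at k A \<and> lc_at (Suc k) M)"
| "lc_at k (LApp M N) = (lc_at k M \<and> lc_at k N)"

primrec ln_close :: "'v \<Rightarrow> nat \<Rightarrow> ('v, 'c) lnterm \<Rightarrow> ('v, 'c) lnterm" where
  "ln_close x k (LVar y) = (if y = x then LBound k else LVar y)"
| "ln_close x k (LBound i) = LBound i"
| "ln_close x k (LConst c) = LConst c"
| "ln_close x k (LProd A B) = LProd (ln_close x k A) (ln_close x (Suc k) B)"
| "ln_close x k (LLam A M) = LLam (ln_close x k A) (ln_close x (Suc k) M)"
| "ln_close x k (LApp M N) = LApp (ln_close x k M) (ln_close x k N)"

text \<open>No shifting is needed below binders, because only \<open>N\<close> with \<open>lc_at 0 N\<close> are substituted.\<close>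

primrec ln_subst :: "'v \<Rightarrow> ('v, 'c) lnterm \<Rightarrow> ('v, 'c) lnterm \<Rightarrow> ('v, 'c) lnterm" where
  "ln_subst x N (LVar y) = (if y = x then N else LVar y)"
| "ln_subst x N (LBound i) = LBound i"
| "ln_subst x N (LConst c) = LConst c"
| "ln_subst x N (LProd A B) = LProd (ln_subst x N A) (ln_subst x N B)"
| "ln_subst x N (LLam A M) = LLam (ln_subst x N A) (ln_subst x N M)"
| "ln_subst x N (LApp M M') = LApp (ln_subst x N M) (ln_subst x N M')"

primrec ln_fv :: "('v, 'c) lnterm \<Rightarrow> 'v set" where
  "ln_fv (LVar x) = {x}"
| "ln_fv (LBound i) = {}"
| "ln_fv (LConst c) = {}"
| "ln_fv (LProd A B) = ln_fv A \<union> ln_fv B"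
| "ln_fv (LLam A M) = ln_fv A \<union> ln_fv M"
| "ln_fv (LApp M N) = ln_fv M \<union> ln_fv N"

lemma lc_at_mono: "lc_at k t \<Longrightarrow> k \<le> l \<Longrightarrow> lc_at l t"
proof (induction t arbitrary: k l)
  case (LProd A B)
  then show ?case using LProd.IH(1)[of k l] LProd.IH(2)[of "Suc k" "Suc l"] by simp
next
  case (LLam A M)
  then show ?case using LLam.IH(1)[of k l] LLam.IH(2)[of "Suc k" "Suc l"] by simp
qed auto

lemma lc_at_close: "lc_at k t \<Longrightarrow> lc_at (Suc k) (ln_close x k t)"
  by (induction t arbitrary: k) auto

lemma lc_at_subst: "lc_at k t \<Longrightarrow> lc_at 0 N \<Longrightarrow> lc_at k (ln_subst x N t)"
  by (induction t arbitrary: k) (auto intro: lc_at_mono)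

typedef ('v, 'c) pterm = "{t :: ('v, 'c) lnterm. lc_at 0 t}"
  by (rule exI[of _ "LVar undefined"]) simp

setup_lifting type_definition_pterm

lift_definition Var :: "'v \<Rightarrow> ('v, 'c) pterm" is LVar
  by simp

lift_definition Const :: "'c \<Rightarrow> ('v, 'c) pterm" is LConst
  by simp

lift_definition PiTy :: "'v \<Rightarrow> ('v, 'c) pterm \<Rightarrow> ('v, 'c) pterm \<Rightarrow> ('v, 'c) pterm"
  is "\<lambda>x A B. LProd A (ln_close x 0 B)"
  by (simp add: lc_at_close)

lift_definition Lam :: "'v \<Rightarrow> ('v, 'c) pterm \<Rightarrow> ('v, 'c) pterm \<Rightarrow> ('v, 'c) pterm"
  is "\<lambda>x A M. LLam A (ln_close x 0 M)"
  by (simp add: lc_at_close)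

lift_definition App :: "('v, 'c) pterm \<Rightarrow> ('v, 'c) pterm \<Rightarrow> ('v, 'c) pterm" is LApp
  by simp

lift_definition subst :: "('v, 'c) pterm \<Rightarrow> 'v \<Rightarrow> ('v, 'c) pterm \<Rightarrow> ('v, 'c) pterm"
    (\<open>_[_ ::= _]\<close> [1000, 0, 0] 1000)
  is "\<lambda>M x N. ln_subst x N M"
  by (simp add: lc_at_subst)

lift_definition fv :: "('v, 'c) pterm \<Rightarrow> 'v set" is ln_fv .

lemma finite_fv: "finite (fv M)"
proof -
  have "finite (ln_fv t)" for t :: "('v, 'c) lnterm"
    by (induction t) auto
  then show ?thesis by (simp add: fv.rep_eq)
qed

lemma ln_fv_close: "ln_fv (ln_close x k t) = ln_fv t - {x}"
  by (induction t arbitrary: k) auto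

lemma fv_simps [simp]:
  "fv (Var x) = {x}"
  "fv (Const c) = {}"
  "fv (PiTy x A B) = fv A \<union> (fv B - {x})"
  "fv (Lam x A M) = fv A \<union> (fv M - {x})"
  "fv (App M N) = fv M \<union> fv N"
  by (transfer; simp add: ln_fv_close)+

lemma ln_close_not_fv: "x \<notin> ln_fv t \<Longrightarrow> ln_close x k t = t"
  by (induction t arbitrary: k) auto

lemma ln_subst_close:
  "x \<noteq> y \<Longrightarrow> y \<notin> ln_fv N \<Longrightarrow> ln_subst x N (ln_close y k t) = ln_close y k (ln_subst x N t)"
  by (induction t arbitrary: k) (auto simp: ln_close_not_fv)

lemma subst_simps [simp]:
  "(Var y)[x ::= N] = (if y = x then N else Var y)"
  "(Const c)[x ::= N] = Const c"
  "(App M M')[x ::= N] = App (M[x ::= N]) (M'[x ::= N])"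
  by (transfer; simp)+

lemma ln_subst_not_fv: "x \<notin> ln_fv t \<Longrightarrow> ln_subst x N t = t"
  by (induction t) auto

lemma subst_same_binder [simp]:
  "(PiTy x A B)[x ::= N] = PiTy x (A[x ::= N]) B"
  "(Lam x A M)[x ::= N] = Lam x (A[x ::= N]) M"
  by (transfer; simp add: ln_subst_not_fv ln_fv_close)+

lemma subst_binder [simp]:
  assumes "x \<noteq> y" "y \<notin> fv N"
  shows "(PiTy y A B)[x ::= N] = PiTy y (A[x ::= N]) (B[x ::= N])"
    and "(Lam y A M)[x ::= N] = Lam y (A[x ::= N]) (M[x ::= N])"
  using assms by (transfer; simp add: ln_subst_close)+

lemma pterm_distinct [simp]:
  "Var x \<noteq> Const c" "Const c \<noteq> Var x"
  "Var x \<noteq> PiTy y A B" "PiTy y A B \<noteq> Var x"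
  "Var x \<noteq> Lam y A M" "Lam y A M \<noteq> Var x"
  "Var x \<noteq> App M N" "App M N \<noteq> Var x"
  "Const c \<noteq> PiTy y A B" "PiTy y A B \<noteq> Const c"
  "Const c \<noteq> Lam y A M" "Lam y A M \<noteq> Const c"
  "Const c \<noteq> App M N" "App M N \<noteq> Const c"
  "PiTy y A B \<noteq> Lam z A' M" "Lam z A' M \<noteq> PiTy y A B"
  "PiTy y A B \<noteq> App M N" "App M N \<noteq> PiTy y A B"
  "Lam y A M' \<noteq> App M N" "App M N \<noteq> Lam y A M'"
  by (transfer; simp)+

lemma pterm_inject [simp]:
  "Var x = Var y \<longleftrightarrow> x = y"
  "Const c = Const d \<longleftrightarrow> c = d"
  "App M N = App M' N' \<longleftrightarrow> M = M' \<and> N = N'"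
  by (transfer; simp)+

lemma ln_close_inj:
  "lc_at k t \<Longrightarrow> lc_at k u \<Longrightarrow> ln_close x k t = ln_close x k u \<Longrightarrow> t = u"
proof (induction t arbitrary: k u)
  case (LVar y) then show ?case by (cases u) (auto split: if_splits)
next
  case (LBound i) then show ?case by (cases u) (auto split: if_splits)
next
  case (LConst c) then show ?case by (cases u) (auto split: if_splits)
next
  case (LProd A B) then show ?case by (cases u) (auto split: if_splits)
next
  case (LLam A M) then show ?case by (cases u) (auto split: if_splits)
next
  case (LApp M N) then show ?case by (cases u) (auto split: if_splits)
qed

lemma ln_close_rename:
  "y \<notin> ln_fv t \<Longrightarrow> ln_close y k (ln_subst x (LVar y) t) = ln_close x k t"
  by (induction t arbitrary: k) auto

lemma ln_close_eq_iff:
  assumes "lc_at 0 t" "lc_at 0 u"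
  shows "ln_close x 0 t = ln_close y 0 u \<longleftrightarrow>
    x = y \<and> t = u \<or> x \<noteq> y \<and> y \<notin> ln_fv t \<and> u = ln_subst x (LVar y) t"
proof (cases "x = y")
  case True
  then show ?thesis using ln_close_inj[OF assms, of x] by auto
next
  case False
  show ?thesis
  proof
    assume eq: "ln_close x 0 t = ln_close y 0 u"
    then have "ln_fv t - {x} = ln_fv u - {y}" by (metis ln_fv_close)
    with False have y: "y \<notin> ln_fv t" by blast
    then have "ln_close y 0 (ln_subst x (LVar y) t) = ln_close y 0 u"
      using eq by (simp add: ln_close_rename)
    moreover have "lc_at 0 (ln_subst x (LVar y) t)"
      using assms by (simp add: lc_at_subst)
    ultimately have "ln_subst x (LVar y) t = u"
      using assms(2) ln_close_inj by fast
    with y False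
    show "x = y \<and> t = u \<or> x \<noteq> y \<and> y \<notin> ln_fv t \<and> u = ln_subst x (LVar y) t" by blast
  qed (use False in \<open>auto simp: ln_close_rename\<close>)
qed

lemma binder_eq_iff:
  "PiTy x A B = PiTy y A' B' \<longleftrightarrow>
    A = A' \<and> (x = y \<and> B = B' \<or> x \<noteq> y \<and> y \<notin> fv B \<and> B' = B[x ::= Var y])"
  "Lam x A B = Lam y A' B' \<longleftrightarrow>
    A = A' \<and> (x = y \<and> B = B' \<or> x \<noteq> y \<and> y \<notin> fv B \<and> B' = B[x ::= Var y])"
  by (transfer; simp add: ln_close_eq_iff)+

lemma lc_at_Suc_obtain_close:
  assumes "lc_at (Suc k) t" "x \<notin> ln_fv t"
  obtains u where "lc_at k u" "t = ln_close x k u" "size u = size t"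
proof -
  have "\<exists>u. lc_at k u \<and> t = ln_close x k u \<and> size u = size t"
    using assms
  proof (induction t arbitrary: k)
    case (LVar y) then show ?case by (intro exI[of _ "LVar y"]) auto
  next
    case (LBound i)
    show ?case
    proof (cases "i = k")
      case True then show ?thesis by (intro exI[of _ "LVar x"]) auto
    next
      case False with LBound show ?thesis by (intro exI[of _ "LBound i"]) auto
    qed
  next
    case (LConst c) then show ?case by (intro exI[of _ "LConst c"]) auto
  next
    case (LProd A B)
    obtain A' B' where "lc_at k A'" "A = ln_close x k A'" "size A' = size A"
      "lc_at (Suc k) B'" "B = ln_close x (Suc k) B'" "size B' = size B"
      using LProd.IH(1)[of k] LProd.IH(2)[of "Suc k"] LProd.prems by auto
    then show ?case by (intro exI[of _ "LProd A' B'"]) auto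
  next
    case (LLam A B)
    obtain A' B' where "lc_at k A'" "A = ln_close x k A'" "size A' = size A"
      "lc_at (Suc k) B'" "B = ln_close x (Suc k) B'" "size B' = size B"
      using LLam.IH(1)[of k] LLam.IH(2)[of "Suc k"] LLam.prems by auto
    then show ?case by (intro exI[of _ "LLam A' B'"]) auto
  next
    case (LApp A B)
    obtain A' B' where "lc_at k A'" "A = ln_close x k A'" "size A' = size A"
      "lc_at k B'" "B = ln_close x k B'" "size B' = size B"
      using LApp.IH(1)[of k] LApp.IH(2)[of "k"] LApp.prems by auto
    then show ?case by (intro exI[of _ "LApp A' B'"]) auto
  qed
  then show thesis using that by blast
qed

text \<open>Induction in which the bound variables avoid a given finite set.\<close>

lemma pterm_strong_induct [case_names finite Var Const PiTy Lam App]: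
  fixes M :: "('v::infinite, 'c) pterm"
  assumes "finite X"
    and "\<And>x. P (Var x)"
    and "\<And>c. P (Const c)"
    and "\<And>x A B. x \<notin> X \<Longrightarrow> x \<notin> fv A \<Longrightarrow> P A \<Longrightarrow> P B \<Longrightarrow> P (PiTy x A B)"
    and "\<And>x A M. x \<notin> X \<Longrightarrow> x \<notin> fv A \<Longrightarrow> P A \<Longrightarrow> P M \<Longrightarrow> P (Lam x A M)"
    and "\<And>M N. P M \<Longrightarrow> P N \<Longrightarrow> P (App M N)"
  shows "P M"
proof (induction "size (Rep_pterm M)" arbitrary: M rule: less_induct)
  case less
  have fin: "finite (ln_fv t)" for t :: "('v, 'c) lnterm"
    by (induction t) auto
  have lc: "lc_at 0 (Rep_pterm M)" using Rep_pterm[of M] by simp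
  show ?case
  proof (cases "Rep_pterm M")
    case (LVar x)
    then have "M = Var x" by (simp add: Rep_pterm_inject[symmetric] Var.rep_eq)
    with assms show ?thesis by simp
  next
    case (LBound i)
    with lc show ?thesis by simp
  next
    case (LConst c)
    then have "M = Const c" by (simp add: Rep_pterm_inject[symmetric] Const.rep_eq)
    with assms show ?thesis by simp
  next
    case (LApp t u)
    with lc have "lc_at 0 t" "lc_at 0 u" by auto
    moreover from this LApp have "M = App (Abs_pterm t) (Abs_pterm u)"
      by (simp add: Rep_pterm_inject[symmetric] App.rep_eq Abs_pterm_inverse)
    ultimately show ?thesis
      using LApp assms(6) less by (simp add: Abs_pterm_inverse)
  next
    case (LProd t u)
    obtain x where x: "x \<notin> X \<union> ln_fv t \<union> ln_fv u"
      using arb_element[of "X \<union> ln_fv t \<union> ln_fv u"] assms(1) fin by blast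
    from lc LProd have lcs: "lc_at 0 t" "lc_at (Suc 0) u" by auto
    from lc_at_Suc_obtain_close[OF lcs(2)] x
    obtain v where v: "lc_at 0 v" "u = ln_close x 0 v" "size v = size u" by blast
    have eq: "M = PiTy x (Abs_pterm t) (Abs_pterm v)"
      using LProd lcs v by (simp add: Rep_pterm_inject[symmetric] PiTy.rep_eq Abs_pterm_inverse)
    have "x \<notin> fv (Abs_pterm t)" using x lcs by (simp add: fv.rep_eq Abs_pterm_inverse)
    moreover have "P (Abs_pterm t)" "P (Abs_pterm v)"
      using LProd lcs v by (auto intro!: less simp: Abs_pterm_inverse)
    ultimately show ?thesis using x unfolding eq by (intro assms(4)) auto
  next
    case (LLam t u)
    obtain x where x: "x \<notin> X \<union> ln_fv t \<union> ln_fv u"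
      using arb_element[of "X \<union> ln_fv t \<union> ln_fv u"] assms(1) fin by blast
    from lc LLam have lcs: "lc_at 0 t" "lc_at (Suc 0) u" by auto
    from lc_at_Suc_obtain_close[OF lcs(2)] x
    obtain v where v: "lc_at 0 v" "u = ln_close x 0 v" "size v = size u" by blast
    have eq: "M = Lam x (Abs_pterm t) (Abs_pterm v)"
      using LLam lcs v by (simp add: Rep_pterm_inject[symmetric] Lam.rep_eq Abs_pterm_inverse)
    have "x \<notin> fv (Abs_pterm t)" using x lcs by (simp add: fv.rep_eq Abs_pterm_inverse)
    moreover have "P (Abs_pterm t)" "P (Abs_pterm v)"
      using LLam lcs v by (auto intro!: less simp: Abs_pterm_inverse)
    ultimately show ?thesis using x unfolding eq by (intro assms(5)) auto
  qed
qed

section \<open>Beta-conversion\<close>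

inductive beta :: "('v, 'c) pterm \<Rightarrow> ('v, 'c) pterm \<Rightarrow> bool" where
  beta_redex: "beta (App (Lam x A M) N) (M[x ::= N])"
| beta_App1: "beta M M' \<Longrightarrow> beta (App M N) (App M' N)"
| beta_App2: "beta N N' \<Longrightarrow> beta (App M N) (App M N')"
| beta_Lam1: "beta A A' \<Longrightarrow> beta (Lam x A M) (Lam x A' M)"
| beta_Lam2: "beta M M' \<Longrightarrow> beta (Lam x A M) (Lam x A M')"
| beta_Prod1: "beta A A' \<Longrightarrow> beta (PiTy x A B) (PiTy x A' B)"
| beta_Prod2: "beta B B' \<Longrightarrow> beta (PiTy x A B) (PiTy x A B')"

abbreviation beta_eq :: "('v, 'c) pterm \<Rightarrow> ('v, 'c) pterm \<Rightarrow> bool" (infix \<open>=\<^sub>\<beta>\<close> 50) where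
  "A =\<^sub>\<beta> B \<equiv> equivclp beta A B"

section \<open>Pure type systems\<close>

text \<open>The set of constants is the universe of the type \<open>'c\<close>.\<close>

record 'c pts =
  Sorts :: "'c set"
  Axioms :: "('c \<times> 'c) set"
  Rules :: "('c \<times> 'c \<times> 'c) set"

definition is_pts :: "'c pts \<Rightarrow> bool" where
  "is_pts X \<longleftrightarrow> Axioms X \<subseteq> UNIV \<times> Sorts X \<and> Rules X \<subseteq> Sorts X \<times> Sorts X \<times> Sorts X"

definition supersorted :: "'c pts \<Rightarrow> bool" where
  "supersorted X \<longleftrightarrow>
    (\<forall>c. \<exists>s\<in>Sorts X. (c, s) \<in> Axioms X) \<and>
    (\<forall>s\<^sub>1\<in>Sorts X. \<forall>s\<^sub>2\<in>Sorts X. \<exists>s\<^sub>3\<in>Sorts X. (s\<^sub>1, s\<^sub>2, s\<^sub>3) \<in> Rules X)"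

type_synonym ('v, 'c) ctxt = "('v \<times> ('v, 'c) pterm) list"

abbreviation extend :: "('v, 'c) ctxt \<Rightarrow> 'v \<Rightarrow> ('v, 'c) pterm \<Rightarrow> ('v, 'c) ctxt"
    (\<open>_,, _ : _\<close> [61, 61, 61] 60) where
  "\<Gamma>,, x : A \<equiv> \<Gamma> @ [(x, A)]"

definition fresh :: "'v \<Rightarrow> ('v, 'c) ctxt \<Rightarrow> bool" where
  "fresh x \<Gamma> \<longleftrightarrow> x \<notin> fst ` set \<Gamma>"

inductive derivable :: "'c pts \<Rightarrow> ('v, 'c) ctxt \<Rightarrow> ('v, 'c) pterm \<Rightarrow> ('v, 'c) pterm \<Rightarrow> bool"
  for X :: "'c pts" where
  axiom: "(c, s) \<in> Axioms X \<Longrightarrow> derivable X [] (Const c) (Const s)"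
| start: "\<lbrakk>derivable X \<Gamma> A (Const s); s \<in> Sorts X; fresh x \<Gamma>\<rbrakk>
    \<Longrightarrow> derivable X (\<Gamma>,, x : A) (Var x) A"
| weakening: "\<lbrakk>derivable X \<Gamma> M B; derivable X \<Gamma> A (Const s); s \<in> Sorts X; fresh x \<Gamma>\<rbrakk>
    \<Longrightarrow> derivable X (\<Gamma>,, x : A) M B"
| application: "\<lbrakk>derivable X \<Gamma> M (PiTy x A B); derivable X \<Gamma> N A\<rbrakk>
    \<Longrightarrow> derivable X \<Gamma> (App M N) (B[x ::= N])"
| abstraction: "\<lbrakk>derivable X (\<Gamma>,, x : A) M B; derivable X \<Gamma> (PiTy x A B) (Const s); s \<in> Sorts X\<rbrakk>
    \<Longrightarrow> derivable X \<Gamma> (Lam x A M) (PiTy x A B)"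
| product: "\<lbrakk>derivable X (\<Gamma>,, x : A) B (Const s\<^sub>2); derivable X \<Gamma> A (Const s\<^sub>1);
      (s\<^sub>1, s\<^sub>2, s\<^sub>3) \<in> Rules X\<rbrakk>
    \<Longrightarrow> derivable X \<Gamma> (PiTy x A B) (Const s\<^sub>3)"
| conversion: "\<lbrakk>derivable X \<Gamma> M A; derivable X \<Gamma> B (Const s); s \<in> Sorts X; A =\<^sub>\<beta> B\<rbrakk>
    \<Longrightarrow> derivable X \<Gamma> M B"

text \<open>The same system, except that the rule \<open>abstraction\<close> loses its second premise.\<close>

inductive derivable' :: "'c pts \<Rightarrow> ('v, 'c) ctxt \<Rightarrow> ('v, 'c) pterm \<Rightarrow> ('v, 'c) pterm \<Rightarrow> bool"
  for X :: "'c pts" where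
  axiom: "(c, s) \<in> Axioms X \<Longrightarrow> derivable' X [] (Const c) (Const s)"
| start: "\<lbrakk>derivable' X \<Gamma> A (Const s); s \<in> Sorts X; fresh x \<Gamma>\<rbrakk>
    \<Longrightarrow> derivable' X (\<Gamma>,, x : A) (Var x) A"
| weakening: "\<lbrakk>derivable' X \<Gamma> M B; derivable' X \<Gamma> A (Const s); s \<in> Sorts X; fresh x \<Gamma>\<rbrakk>
    \<Longrightarrow> derivable' X (\<Gamma>,, x : A) M B"
| application: "\<lbrakk>derivable' X \<Gamma> M (PiTy x A B); derivable' X \<Gamma> N A\<rbrakk>
    \<Longrightarrow> derivable' X \<Gamma> (App M N) (B[x ::= N])"
| abstraction': "derivable' X (\<Gamma>,, x : A) M B
    \<Longrightarrow> derivable' X \<Gamma> (Lam x A M) (PiTy x A B)"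
| product: "\<lbrakk>derivable' X (\<Gamma>,, x : A) B (Const s\<^sub>2); derivable' X \<Gamma> A (Const s\<^sub>1);
      (s\<^sub>1, s\<^sub>2, s\<^sub>3) \<in> Rules X\<rbrakk>
    \<Longrightarrow> derivable' X \<Gamma> (PiTy x A B) (Const s\<^sub>3)"
| conversion: "\<lbrakk>derivable' X \<Gamma> M A; derivable' X \<Gamma> B (Const s); s \<in> Sorts X; A =\<^sub>\<beta> B\<rbrakk>
    \<Longrightarrow> derivable' X \<Gamma> M B"

end

theory Submission
  imports Defs
begin

text \<open>
  By supersortedness every inhabited type is itself typed by a sort: if \<open>\<Gamma> \<turnstile> M : B\<close> then
  \<open>\<Gamma> \<turnstile> B : s\<close> for some sort \<open>s\<close>. Hence \<open>\<Gamma>, x:A \<turnstile> M : B\<close> yields \<open>\<Gamma>, x:A \<turnstile> B : s\<close>, and with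
  \<open>\<Gamma> \<turnstile> A : s'\<close> the product \<open>\<Pi>x:A. B\<close> has a sort, which is the premise that the simplified
  abstraction rule omits. The only difficult case of type correctness is application, which needs
  the substitution lemma. It is proved for simultaneous substitutions that map one context into
  another: passing under a binder then only requires the weakening rule and the choice of a
  fresh name for the bound variable, so that thinning and renaming need no separate proof.
\<close>

section \<open>Simultaneous substitution\<close>

primrec ln_msubst :: "('v \<Rightarrow> ('v, 'c) lnterm) \<Rightarrow> ('v, 'c) lnterm \<Rightarrow> ('v, 'c) lnterm" where
  "ln_msubst \<sigma> (LVar y) = \<sigma> y"
| "ln_msubst \<sigma> (LBound i) = LBound i"
| "ln_msubst \<sigma> (LConst c) = LConst c"
| "ln_msubst \<sigma> (LProd A B) = LProd (ln_msubst \<sigma> A) (ln_msubst \<sigma> B)"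
| "ln_msubst \<sigma> (LLam A M) = LLam (ln_msubst \<sigma> A) (ln_msubst \<sigma> M)"
| "ln_msubst \<sigma> (LApp M N) = LApp (ln_msubst \<sigma> M) (ln_msubst \<sigma> N)"

lemma lc_at_msubst: "lc_at k t \<Longrightarrow> (\<And>y. lc_at 0 (\<sigma> y)) \<Longrightarrow> lc_at k (ln_msubst \<sigma> t)"
  by (induction t arbitrary: k) (auto intro: lc_at_mono)

text \<open>Closing over \<open>x'\<close> must bind exactly the occurrences that come from
  \<open>x\<close>, so \<open>x'\<close> may not occur in the images of the other free variables.
  Both \<open>x' = x\<close> and a renamed binder are allowed.\<close>

lemma ln_msubst_close:
  "x' \<notin> (\<Union>y\<in>ln_fv t - {x}. ln_fv (\<sigma> y)) \<Longrightarrow>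
    ln_msubst \<sigma> (ln_close x k t) = ln_close x' k (ln_msubst (\<sigma>(x := LVar x')) t)"
  by (induction t arbitrary: k) (auto simp: ln_close_not_fv)

lemma ln_msubst_subst:
  "x' \<notin> (\<Union>y\<in>ln_fv t - {x}. ln_fv (\<sigma> y)) \<Longrightarrow>
    ln_msubst \<sigma> (ln_subst x N t) =
    ln_subst x' (ln_msubst \<sigma> N) (ln_msubst (\<sigma>(x := LVar x')) t)"
  by (induction t) (auto simp: ln_subst_not_fv)

lemma ln_msubst_cong:
  "(\<And>y. y \<in> ln_fv t \<Longrightarrow> \<sigma> y = \<tau> y) \<Longrightarrow> ln_msubst \<sigma> t = ln_msubst \<tau> t"
  by (induction t) auto

lemma ln_msubst_single: "ln_msubst (LVar(x := N)) t = ln_subst x N t"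
  by (induction t) auto

lemma ln_subst_rename: "y \<notin> ln_fv t \<Longrightarrow> ln_subst y N (ln_subst x (LVar y) t) = ln_subst x N t"
  by (induction t) auto

lemma ln_fv_subst: "ln_fv (ln_subst x N t) \<subseteq> ln_fv t - {x} \<union> ln_fv N"
  by (induction t) auto

lift_definition msubst :: "('v \<Rightarrow> ('v, 'c) pterm) \<Rightarrow> ('v, 'c) pterm \<Rightarrow> ('v, 'c) pterm"
  is ln_msubst
  by (simp add: lc_at_msubst)

lemma msubst_simps [simp]:
  "msubst \<sigma> (Var y) = \<sigma> y"
  "msubst \<sigma> (Const c) = Const c"
  "msubst \<sigma> (App M N) = App (msubst \<sigma> M) (msubst \<sigma> N)"
  by (transfer; simp)+

lemma msubst_binder:
  assumes "x' \<notin> (\<Union>y\<in>fv B - {x}. fv (\<sigma> y))"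
  shows "msubst \<sigma> (PiTy x A B) = PiTy x' (msubst \<sigma> A) (msubst (\<sigma>(x := Var x')) B)"
    and "msubst \<sigma> (Lam x A B) = Lam x' (msubst \<sigma> A) (msubst (\<sigma>(x := Var x')) B)"
  using assms by (transfer; simp add: ln_msubst_close)+

lemma msubst_subst:
  assumes "x' \<notin> (\<Union>y\<in>fv M - {x}. fv (\<sigma> y))"
  shows "msubst \<sigma> (M[x ::= N]) = (msubst (\<sigma>(x := Var x')) M)[x' ::= msubst \<sigma> N]"
  using assms by (transfer; simp add: ln_msubst_subst)

lemma msubst_cong: "(\<And>y. y \<in> fv M \<Longrightarrow> \<sigma> y = \<tau> y) \<Longrightarrow> msubst \<sigma> M = msubst \<tau> M"
  by transfer (rule ln_msubst_cong)

lemma msubst_single: "msubst (Var(x := N)) M = M[x ::= N]"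
  by transfer (rule ln_msubst_single)

lemma fv_subst: "fv (M[x ::= N]) \<subseteq> fv M - {x} \<union> fv N"
  by transfer (rule ln_fv_subst)

lemma subst_not_fv: "x \<notin> fv M \<Longrightarrow> M[x ::= N] = M"
  by transfer (rule ln_subst_not_fv)

lemma subst_rename: "y \<notin> fv M \<Longrightarrow> M[x ::= Var y][y ::= N] = M[x ::= N]"
  by transfer (rule ln_subst_rename)

text \<open>Two terms are avoided at once because one name must serve both sides of a beta step
  under a binder, or both the body of an abstraction and the body of its type.\<close>

lemma obtain_fresh_binder:
  fixes \<sigma> :: "'v::infinite \<Rightarrow> ('v, 'c) pterm" and M N :: "('v, 'c) pterm"
  assumes "finite F"
  obtains x' where "x' \<notin> F" "x' \<notin> (\<Union>y\<in>fv M - {x}. fv (\<sigma> y))" "x' \<notin> (\<Union>y\<in>fv N - {x}. fv (\<sigma> y))"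
proof -
  have "finite (F \<union> (\<Union>y\<in>fv M \<union> fv N. fv (\<sigma> y)))"
    using assms by (simp add: finite_fv)
  then obtain x' where "x' \<notin> F \<union> (\<Union>y\<in>fv M \<union> fv N. fv (\<sigma> y))"
    using arb_element by blast
  then show thesis by (intro that) auto
qed

lemma beta_msubst:
  fixes M :: "('v::infinite, 'c) pterm"
  shows "beta M M' \<Longrightarrow> beta (msubst \<sigma> M) (msubst \<sigma> M')"
proof (induction arbitrary: \<sigma> rule: beta.induct)
  case (beta_redex x A M N)
  obtain x' where "x' \<notin> (\<Union>y\<in>fv M - {x}. fv (\<sigma> y))"
    using obtain_fresh_binder[of "{}"] by blast
  then show ?case by (simp add: msubst_binder msubst_subst beta.beta_redex)
next
  case (beta_Lam1 A A' x M)
  obtain x' where "x' \<notin> (\<Union>y\<in>fv M - {x}. fv (\<sigma> y))"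
    using obtain_fresh_binder[of "{}"] by blast
  then show ?case using beta_Lam1.IH by (simp add: msubst_binder beta.beta_Lam1)
next
  case (beta_Lam2 M M' x A)
  obtain x' where "x' \<notin> (\<Union>y\<in>fv M - {x}. fv (\<sigma> y))" "x' \<notin> (\<Union>y\<in>fv M' - {x}. fv (\<sigma> y))"
    using obtain_fresh_binder[of "{}"] by blast
  then show ?case using beta_Lam2.IH by (simp add: msubst_binder beta.beta_Lam2)
next
  case (beta_Prod1 A A' x B)
  obtain x' where "x' \<notin> (\<Union>y\<in>fv B - {x}. fv (\<sigma> y))"
    using obtain_fresh_binder[of "{}"] by blast
  then show ?case using beta_Prod1.IH by (simp add: msubst_binder beta.beta_Prod1)
next
  case (beta_Prod2 B B' x A)
  obtain x' where "x' \<notin> (\<Union>y\<in>fv B - {x}. fv (\<sigma> y))" "x' \<notin> (\<Union>y\<in>fv B' - {x}. fv (\<sigma> y))"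
    using obtain_fresh_binder[of "{}"] by blast
  then show ?case using beta_Prod2.IH by (simp add: msubst_binder beta.beta_Prod2)
qed (auto intro: beta.intros)

lemma beta_eq_msubst:
  fixes A :: "('v::infinite, 'c) pterm"
  assumes "A =\<^sub>\<beta> B"
  shows "msubst \<sigma> A =\<^sub>\<beta> msubst \<sigma> B"
  using assms
proof (induction rule: equivclp_induct)
  case base
  show ?case by (rule equivclp_refl)
next
  case (step B C)
  \<comment> \<open>A link of the conversion chain may be a beta step in either direction, hence the
    symmetry.\<close>
  then have "msubst \<sigma> B =\<^sub>\<beta> msubst \<sigma> C"
    by (metis beta_msubst r_into_equivclp equivclp_sym)
  with step.IH show ?case by (rule equivclp_trans)
qed

section \<open>Contexts of derivable judgements\<close>

text \<open>The derivation of \<open>M\<close> only witnesses that \<Gamma> is legal: its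
  \<open>start\<close> and \<open>weakening\<close> steps are replayed as weakenings of the
  axiom.\<close>

lemma derivable_axiom:
  "derivable X \<Gamma> M B \<Longrightarrow> (c, s) \<in> Axioms X \<Longrightarrow> derivable X \<Gamma> (Const c) (Const s)"
  by (induction rule: derivable.induct) (auto intro: derivable.axiom derivable.weakening)

lemma derivable_var:
  "derivable X \<Gamma> M B \<Longrightarrow> (y, C) \<in> set \<Gamma> \<Longrightarrow> derivable X \<Gamma> (Var y) C"
  by (induction rule: derivable.induct) (auto intro: derivable.start derivable.weakening)

text \<open>Only \<open>start\<close> and \<open>weakening\<close> lengthen a context; every other
  rule with a nonempty context has a premise in that same context.\<close>

lemma derivable_extendD:
  assumes "derivable X (\<Gamma>,, x : A) M B"
  shows "fresh x \<Gamma>" and "\<exists>s\<in>Sorts X. derivable X \<Gamma> A (Const s)"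
proof -
  have "fresh x \<Gamma> \<and> (\<exists>s\<in>Sorts X. derivable X \<Gamma> A (Const s))"
    using assms by (induction "\<Gamma>,, x : A" M B rule: derivable.induct) auto
  then show "fresh x \<Gamma>" and "\<exists>s\<in>Sorts X. derivable X \<Gamma> A (Const s)" by auto
qed

lemma derivable_fv: "derivable X \<Gamma> M B \<Longrightarrow> fv M \<union> fv B \<subseteq> fst ` set \<Gamma>"
proof (induction rule: derivable.induct)
  case (application \<Gamma> M x A B N)
  then show ?case using fv_subst[of B x N] by auto
qed auto

lemma derivable_ctxt_fv:
  assumes "derivable X \<Gamma> M B" "(y, C) \<in> set \<Gamma>" "fresh x \<Gamma>"
  shows "y \<noteq> x" "x \<notin> fv C"
  using derivable_fv[OF derivable_var[OF assms(1,2)]] assms(2,3) by (force simp: fresh_def)+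

section \<open>The substitution lemma\<close>

text \<open>The first conjunct makes \<Theta> legal even when \<Gamma> is empty, as the
  \<open>axiom\<close> case of the substitution lemma requires.\<close>

definition ctxt_morphism ::
  "'c pts \<Rightarrow> ('v, 'c) ctxt \<Rightarrow> ('v \<Rightarrow> ('v, 'c) pterm) \<Rightarrow> ('v, 'c) ctxt \<Rightarrow> bool" where
  "ctxt_morphism X \<Gamma> \<sigma> \<Theta> \<longleftrightarrow>
    (\<exists>M B. derivable X \<Theta> M B) \<and> (\<forall>(y, C)\<in>set \<Gamma>. derivable X \<Theta> (\<sigma> y) (msubst \<sigma> C))"

text \<open>Since \<open>x\<close> is fresh for \<Gamma>, it occurs neither in \<open>A\<close> nor
  in the types declared in \<Gamma>, so updating \<sigma> at \<open>x\<close> leaves their images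
  unchanged; weakening does the rest.\<close>

lemma ctxt_morphism_extend:
  assumes ext: "derivable X (\<Gamma>,, x : A) M B"
    and mor: "ctxt_morphism X \<Gamma> \<sigma> \<Theta>"
    and A: "derivable X \<Theta> (msubst \<sigma> A) (Const s)" "s \<in> Sorts X"
    and x': "fresh x' \<Theta>"
  shows "ctxt_morphism X (\<Gamma>,, x : A) (\<sigma>(x := Var x')) (\<Theta>,, x' : msubst \<sigma> A)"
proof -
  let ?\<tau> = "\<sigma>(x := Var x')" and ?\<Theta> = "\<Theta>,, x' : msubst \<sigma> A"
  obtain r where r: "derivable X \<Gamma> A (Const r)" and x: "fresh x \<Gamma>"
    using derivable_extendD[OF ext] by blast
  have "x \<notin> fv A" using derivable_fv[OF r] x by (auto simp: fresh_def)
  then have eqA: "msubst ?\<tau> A = msubst \<sigma> A" by (intro msubst_cong) auto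
  have var: "derivable X ?\<Theta> (Var x') (msubst \<sigma> A)" using A x' by (rule derivable.start)
  have "derivable X ?\<Theta> (?\<tau> y) (msubst ?\<tau> C)" if yC: "(y, C) \<in> set (\<Gamma>,, x : A)" for y C
  proof (cases "(y, C) \<in> set \<Gamma>")
    case True
    note y = derivable_ctxt_fv[OF r True x]
    have "msubst ?\<tau> C = msubst \<sigma> C" using y by (intro msubst_cong) auto
    moreover have "derivable X \<Theta> (\<sigma> y) (msubst \<sigma> C)"
      using mor True by (auto simp: ctxt_morphism_def)
    ultimately show ?thesis using y derivable.weakening[OF _ A x'] by simp
  next
    case False
    with yC var eqA show ?thesis by simp
  qed
  with var show ?thesis unfolding ctxt_morphism_def by blast
qed

lemma derivable_PiTy_domain:
  assumes "is_pts X"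
  shows "derivable X \<Gamma> (PiTy x A B) C \<Longrightarrow> \<exists>s\<in>Sorts X. derivable X \<Gamma> A (Const s)"
proof (induction \<Gamma> "PiTy x A B" C rule: derivable.induct)
  case (product \<Gamma> y A' B' s\<^sub>2 s\<^sub>1 s\<^sub>3)
  then show ?case using assms by (auto simp: is_pts_def binder_eq_iff)
qed (auto intro: derivable.weakening)

text \<open>\<sigma> and \<Theta> are generalized because the premises under a binder extend both
  contexts. The new name \<open>x'\<close> is fresh for \<Theta>, so that \<Theta> can grow, and
  avoids capture in the bodies.\<close>

lemma derivable_msubst:
  fixes \<Gamma> \<Theta> :: "('v::infinite, 'c) ctxt"
  assumes "is_pts X"
  shows "derivable X \<Gamma> M B \<Longrightarrow> ctxt_morphism X \<Gamma> \<sigma> \<Theta> \<Longrightarrow>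
    derivable X \<Theta> (msubst \<sigma> M) (msubst \<sigma> B)"
proof (induction arbitrary: \<sigma> \<Theta> rule: derivable.induct)
  case (axiom c s)
  then show ?case by (auto simp: ctxt_morphism_def intro: derivable_axiom)
next
  case (start \<Gamma> A s x)
  then show ?case by (auto simp: ctxt_morphism_def)
next
  case (weakening \<Gamma> M B A s x)
  then show ?case by (auto simp: ctxt_morphism_def)
next
  case (application \<Gamma> M x A B N)
  obtain x' where x': "x' \<notin> (\<Union>y\<in>fv B - {x}. fv (\<sigma> y))"
    using obtain_fresh_binder[of "{}"] by blast
  have "derivable X \<Theta> (msubst \<sigma> M) (PiTy x' (msubst \<sigma> A) (msubst (\<sigma>(x := Var x')) B))"
    using application.IH(1)[OF application.prems] x' by (simp add: msubst_binder)
  from derivable.application[OF this application.IH(2)[OF application.prems]]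
  show ?case using x' by (simp add: msubst_subst)
next
  case (abstraction \<Gamma> x A M B s)
  have "finite (fst ` set \<Theta>)" by simp
  then obtain x' where x': "x' \<notin> fst ` set \<Theta>" "x' \<notin> (\<Union>y\<in>fv M - {x}. fv (\<sigma> y))"
    "x' \<notin> (\<Union>y\<in>fv B - {x}. fv (\<sigma> y))"
    by (rule obtain_fresh_binder)
  have prod: "derivable X \<Theta> (PiTy x' (msubst \<sigma> A) (msubst (\<sigma>(x := Var x')) B)) (Const s)"
    using abstraction.IH(2)[OF abstraction.prems] x' by (simp add: msubst_binder)
  \<comment> \<open>No induction hypothesis speaks about \<open>A\<close> alone; its sort is read
    off the substituted product.\<close>
  obtain r where r: "derivable X \<Theta> (msubst \<sigma> A) (Const r)" "r \<in> Sorts X"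
    using derivable_PiTy_domain[OF assms prod] by blast
  have "fresh x' \<Theta>" using x' by (simp add: fresh_def)
  note abstraction.IH(1)[OF ctxt_morphism_extend[OF abstraction.hyps(1) abstraction.prems r this]]
  from derivable.abstraction[OF this prod abstraction.hyps(3)]
  show ?case using x' by (simp add: msubst_binder del: fun_upd_apply)
next
  case (product \<Gamma> x A B s\<^sub>2 s\<^sub>1 s\<^sub>3)
  obtain x' where x': "x' \<notin> fst ` set \<Theta>" "x' \<notin> (\<Union>y\<in>fv B - {x}. fv (\<sigma> y))"
    by (rule obtain_fresh_binder[where F = "fst ` set \<Theta>" and M = B and N = B]) auto
  have A: "derivable X \<Theta> (msubst \<sigma> A) (Const s\<^sub>1)" "s\<^sub>1 \<in> Sorts X"
    using product.IH(2)[OF product.prems] product.hyps(3) assms by (auto simp: is_pts_def)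
  have "fresh x' \<Theta>" using x' by (simp add: fresh_def)
  note product.IH(1)[OF ctxt_morphism_extend[OF product.hyps(1) product.prems A this]]
  from derivable.product[OF this[unfolded msubst_simps] A(1) product.hyps(3)]
  show ?case using x' by (simp add: msubst_binder del: fun_upd_apply)
next
  case (conversion \<Gamma> M A B s)
  have "derivable X \<Theta> (msubst \<sigma> B) (Const s)"
    using conversion.IH(2)[OF conversion.prems] by simp
  with conversion.IH(1)[OF conversion.prems] show ?case
    using conversion.hyps beta_eq_msubst by (blast intro: derivable.conversion)
qed

section \<open>Type correctness\<close>

text \<open>
  The product may have been formed in a smaller context \<open>\<Gamma>'\<close> with a bound name \<open>y\<close> that clashes
  with a later declaration in \<open>\<Gamma>\<close>; hence \<open>\<Gamma>'\<close> cannot simply be replaced by \<open>\<Gamma>\<close>.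
\<close>

lemma derivable_PiTy_codomain:
  assumes "is_pts X"
  shows "derivable X \<Gamma> (PiTy x A B) C \<Longrightarrow>
    \<exists>\<Gamma>' y B'. \<exists>s\<in>Sorts X. set \<Gamma>' \<subseteq> set \<Gamma> \<and> PiTy x A B = PiTy y A B' \<and>
      derivable X (\<Gamma>',, y : A) B' (Const s)"
proof (induction \<Gamma> "PiTy x A B" C rule: derivable.induct)
  case (weakening \<Gamma> C D s z)
  then obtain \<Gamma>' y B' r where "r \<in> Sorts X" "set \<Gamma>' \<subseteq> set \<Gamma>" "PiTy x A B = PiTy y A B'"
    "derivable X (\<Gamma>',, y : A) B' (Const r)"
    by blast
  moreover from this have "set \<Gamma>' \<subseteq> set (\<Gamma>,, z : D)" by auto
  ultimately show ?case by blast
next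
  case (product \<Gamma> y A' B' s\<^sub>2 s\<^sub>1 s\<^sub>3)
  have "A' = A" using product.hyps by (simp add: binder_eq_iff)
  moreover have "s\<^sub>2 \<in> Sorts X" using product.hyps assms by (auto simp: is_pts_def)
  ultimately show ?case
    using product.hyps by (intro exI[of _ \<Gamma>] exI[of _ y] exI[of _ B'] bexI[of _ s\<^sub>2]) simp_all
next
  case (conversion \<Gamma> C D s)
  then show ?case by blast
qed (simp_all only: pterm_distinct)

text \<open>The map sending \<open>y\<close> to \<open>N\<close> and fixing all else is a morphism
  from the extended \<Gamma>' directly into \<Gamma>. It instantiates and thins in one step, so a
  clash of \<open>y\<close> with \<Gamma> is harmless.\<close>

lemma derivable_PiTy_instance:
  fixes \<Gamma> :: "('v::infinite, 'c) ctxt"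
  assumes X: "is_pts X"
    and prod: "derivable X \<Gamma> (PiTy x A B) C" and N: "derivable X \<Gamma> N A"
  shows "\<exists>s\<in>Sorts X. derivable X \<Gamma> (B[x ::= N]) (Const s)"
proof -
  obtain \<Gamma>' y B' s where s: "s \<in> Sorts X" and sub: "set \<Gamma>' \<subseteq> set \<Gamma>"
    and eq: "PiTy x A B = PiTy y A B'" and B': "derivable X (\<Gamma>',, y : A) B' (Const s)"
    using derivable_PiTy_codomain[OF X prod] by blast
  obtain r where r: "derivable X \<Gamma>' A (Const r)" and y: "fresh y \<Gamma>'"
    using derivable_extendD[OF B'] by blast
  have "y \<notin> fv A" using derivable_fv[OF r] y by (auto simp: fresh_def)
  then have "ctxt_morphism X (\<Gamma>',, y : A) (Var(y := N)) \<Gamma>"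
    using N sub derivable_ctxt_fv[OF r _ y] derivable_var[OF N]
    by (auto simp: ctxt_morphism_def msubst_single subst_not_fv)
  from derivable_msubst[OF X B' this] have "derivable X \<Gamma> (B'[y ::= N]) (Const s)"
    by (simp add: msubst_single)
  \<comment> \<open>The two presentations of the product may differ in the bound name; instantiating
    by \<open>N\<close> erases the difference.\<close>
  moreover have "B'[y ::= N] = B[x ::= N]"
  proof (cases "x = y")
    case False
    then have "y \<notin> fv B" "B' = B[x ::= Var y]" using eq by (auto simp: binder_eq_iff)
    then show ?thesis by (simp add: subst_rename)
  qed (use eq in \<open>auto simp: binder_eq_iff\<close>)
  ultimately show ?thesis using s by auto
qed

text \<open>In the \<open>axiom\<close> and \<open>product\<close> cases the type is itself a
  constant, which supersortedness types by a sort. In \<open>abstraction\<close> and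
  \<open>conversion\<close> a premise already is the answer.\<close>

lemma type_correctness:
  fixes \<Gamma> :: "('v::infinite, 'c) ctxt"
  assumes X: "is_pts X" "supersorted X"
  shows "derivable X \<Gamma> M B \<Longrightarrow> \<exists>s\<in>Sorts X. derivable X \<Gamma> B (Const s)"
proof (induction rule: derivable.induct)
  case (axiom c s)
  then show ?case using X(2) by (meson derivable.axiom supersorted_def)
next
  case (application \<Gamma> M x A B N)
  then show ?case using derivable_PiTy_instance[OF X(1)] by blast
next
  case (product \<Gamma> x A B s\<^sub>2 s\<^sub>1 s\<^sub>3)
  then show ?case using X(2) by (meson derivable_axiom supersorted_def)
qed (auto intro: derivable.weakening)

lemma derivable_Lam:
  fixes \<Gamma> :: "('v::infinite, 'c) ctxt"
  assumes X: "is_pts X" "supersorted X" and M: "derivable X (\<Gamma>,, x : A) M B"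
  shows "derivable X \<Gamma> (Lam x A M) (PiTy x A B)"
proof -
  obtain s\<^sub>1 where A: "s\<^sub>1 \<in> Sorts X" "derivable X \<Gamma> A (Const s\<^sub>1)"
    using derivable_extendD[OF M] by blast
  obtain s\<^sub>2 where B: "s\<^sub>2 \<in> Sorts X" "derivable X (\<Gamma>,, x : A) B (Const s\<^sub>2)"
    using type_correctness[OF X M] by blast
  obtain s\<^sub>3 where "s\<^sub>3 \<in> Sorts X" "(s\<^sub>1, s\<^sub>2, s\<^sub>3) \<in> Rules X"
    using X(2) A(1) B(1) unfolding supersorted_def by blast
  then show ?thesis
    using derivable.abstraction[OF M] derivable.product[OF B(2) A(2)] by blast
qed

lemma derivable_imp_derivable': "derivable X \<Gamma> M B \<Longrightarrow> derivable' X \<Gamma> M B"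
  by (induction rule: derivable.induct) (auto intro: derivable'.intros)

text \<open>Each use of \<open>abstraction'\<close> is simulated by \<open>derivable_Lam\<close>;
  all other rules are shared.\<close>

lemma derivable'_imp_derivable:
  fixes \<Gamma> :: "('v::infinite, 'c) ctxt"
  assumes X: "is_pts X" "supersorted X"
  shows "derivable' X \<Gamma> M B \<Longrightarrow> derivable X \<Gamma> M B"
  by (induction rule: derivable'.induct) (auto intro: derivable.intros derivable_Lam[OF X])

theorem theorem16:
  fixes X :: "'c pts"
  assumes "is_pts X" and "supersorted X"
  shows "(\<forall>(\<Gamma> :: ('v::infinite, 'c) ctxt) x A M B.
            derivable X (\<Gamma>,, x : A) M B \<longrightarrow> derivable X \<Gamma> (Lam x A M) (PiTy x A B)) \<and>
         {(\<Gamma> :: ('v, 'c) ctxt, M, A). derivable' X \<Gamma> M A} =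
         {(\<Gamma>, M, A). derivable X \<Gamma> M A}"
  using derivable_Lam[OF assms] derivable'_imp_derivable[OF assms] derivable_imp_derivable'
  by blast

end
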